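(* Let $n,m\ge 1$ be integers. The game $CFG(n,m)$, whose positions are the partitions of $n$ and whose moves are the allowed $CFG(n,m)$ transitions, is a strongly convergent game.
   Context: A partition of $n$ is a sequence $x=(x_1,\ldots,x_n)$ of nonnegative integers with $x_1\ge\cdots\ge x_n$ and $\sum x_i=n$ (with $x_j=0$ for $j>n$). The $CFG(n,m)$ transition at position $i$ is allowed on a partition $x$ of $n$ when $x_i-x_{i+1}\ge m+1$, and replaces $x_i$ by $x_i-m$ and $x_j$ by $x_j+1$ for each $j\in\{i+1,\ldots,i+m\}$, leaving the other entries unchanged (the result is again a partition of $n$). A game is said to be strongly convergent if, given any starting position, either every play sequence can be continued indefinitely, or every play sequence will converge to the same terminal position in the same number of moves. *)

theory Defs
  imports Main
begin

section \<open>Strongly convergent games\<close>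

text \<open>
  A game is given by its set \<open>P\<close> of positions and its move relation \<open>M\<close>, where \<open>M x y\<close> says that
  some allowed move leads from \<open>x\<close> to \<open>y\<close>. A finite play is the nonempty list of the
  positions passed through, so a play \<open>xs\<close> consists of \<open>length xs - 1\<close> moves.
\<close>

definition finite_play :: "('a \<Rightarrow> 'a \<Rightarrow> bool) \<Rightarrow> 'a \<Rightarrow> 'a list \<Rightarrow> bool" where
  "finite_play M x xs \<longleftrightarrow> xs \<noteq> [] \<and> hd xs = x \<and> successively M xs"

definition infinite_play :: "('a \<Rightarrow> 'a \<Rightarrow> bool) \<Rightarrow> 'a \<Rightarrow> (nat \<Rightarrow> 'a) \<Rightarrow> bool" where
  "infinite_play M x f \<longleftrightarrow> f 0 = x \<and> (\<forall>k. M (f k) (f (Suc k)))"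

definition terminal :: "('a \<Rightarrow> 'a \<Rightarrow> bool) \<Rightarrow> 'a \<Rightarrow> bool" where
  "terminal M x \<longleftrightarrow> (\<nexists>y. M x y)"

definition continuable_forever :: "('a \<Rightarrow> 'a \<Rightarrow> bool) \<Rightarrow> 'a list \<Rightarrow> bool" where
  "continuable_forever M xs \<longleftrightarrow>
     (\<exists>f. infinite_play M (hd xs) f \<and> (\<forall>k<length xs. f k = xs ! k))"

text \<open>
  All plays from \<open>x\<close> converge to \<open>t\<close> in \<open>N\<close> moves: no play goes on forever, and every play
  that can no longer be continued has stopped at \<open>t\<close> after exactly \<open>N\<close> moves.
\<close>

definition all_plays_converge :: "('a \<Rightarrow> 'a \<Rightarrow> bool) \<Rightarrow> 'a \<Rightarrow> 'a \<Rightarrow> nat \<Rightarrow> bool" where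
  "all_plays_converge M x t N \<longleftrightarrow>
     (\<nexists>f. infinite_play M x f) \<and>
     (\<forall>xs. finite_play M x xs \<and> terminal M (last xs) \<longrightarrow> last xs = t \<and> length xs - 1 = N)"

definition strongly_convergent :: "'a set \<Rightarrow> ('a \<Rightarrow> 'a \<Rightarrow> bool) \<Rightarrow> bool" where
  "strongly_convergent P M \<longleftrightarrow>
     (\<forall>x\<in>P. (\<forall>xs. finite_play M x xs \<longrightarrow> continuable_forever M xs) \<or>
            (\<exists>t\<in>P. terminal M t \<and> (\<exists>N. all_plays_converge M x t N)))"

section \<open>The game CFG\<close>

text \<open>
  A partition \<open>x\<^sub>1 \<ge> \<dots> \<ge> x\<^sub>n\<close> of \<open>n\<close> is a function indexed from 1, extended by 0 beyond \<open>n\<close>.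
  The unused argument 0 is also sent to 0, so that each partition has exactly one representative.
\<close>

definition partitions :: "nat \<Rightarrow> (nat \<Rightarrow> nat) set" where
  "partitions n = {x. x 0 = 0 \<and> (\<forall>j>n. x j = 0) \<and>
     (\<forall>i\<in>{1..<n}. x i \<ge> x (i + 1)) \<and> (\<Sum>i=1..n. x i) = n}"

definition cfg_allowed :: "nat \<Rightarrow> nat \<Rightarrow> (nat \<Rightarrow> nat) \<Rightarrow> nat \<Rightarrow> bool" where
  "cfg_allowed n m x i \<longleftrightarrow> i \<in> {1..n} \<and> x i \<ge> x (i + 1) + (m + 1)"

definition cfg_fire :: "nat \<Rightarrow> (nat \<Rightarrow> nat) \<Rightarrow> nat \<Rightarrow> (nat \<Rightarrow> nat)" where
  "cfg_fire m x i =
     (\<lambda>j. if j = i then x i - m else if j \<in> {i + 1..i + m} then x j + 1 else x j)"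

definition cfg_move :: "nat \<Rightarrow> nat \<Rightarrow> (nat \<Rightarrow> nat) \<Rightarrow> (nat \<Rightarrow> nat) \<Rightarrow> bool" where
  "cfg_move n m x y \<longleftrightarrow> (\<exists>i. cfg_allowed n m x i \<and> y = cfg_fire m x i)"

text \<open>
  Transitions lead from partitions of \<open>n\<close> to partitions of \<open>n\<close>; in particular the
  positions \<open>i + 1, \<dots>, i + m\<close> do not go beyond \<open>n\<close>.
\<close>

lemma partitions_antimono:
  assumes "x \<in> partitions n" "1 \<le> i" "i \<le> j"
  shows "x j \<le> x i"
  using assms(3)
proof (induction j rule: dec_induct)
  case (step k)
  have "x (Suc k) \<le> x k"
    using assms(1,2) step.hyps by (cases "k < n") (auto simp: partitions_def)
  with step.IH show ?case by simp
qed simp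

lemma cfg_allowed_bound:
  assumes x: "x \<in> partitions n" and a: "cfg_allowed n m x i"
  shows "i + m \<le> n"
proof -
  have i: "1 \<le> i" "i \<le> n" "m + 1 \<le> x i" using a by (auto simp: cfg_allowed_def)
  have "i * (m + 1) = (\<Sum>k=1..i. m + 1)" by simp
  also have "\<dots> \<le> (\<Sum>k=1..i. x k)"
  proof (rule sum_mono)
    fix k assume "k \<in> {1..i}"
    then have "x i \<le> x k" using partitions_antimono[OF x] by simp
    with i(3) show "m + 1 \<le> x k" by simp
  qed
  also have "\<dots> \<le> (\<Sum>k=1..n. x k)" by (rule sum_mono2) (use i in auto)
  also have "\<dots> = n" using x by (simp add: partitions_def)
  finally have "i * m + i \<le> n" by simp
  moreover have "m \<le> i * m" using i(1) by (cases i) auto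
  ultimately show ?thesis by linarith
qed

lemma cfg_move_partitions:
  assumes x: "x \<in> partitions n" and mv: "cfg_move n m x y"
  shows "y \<in> partitions n"
proof -
  obtain i where a: "cfg_allowed n m x i" and y: "y = cfg_fire m x i"
    using mv by (auto simp: cfg_move_def)
  have i: "1 \<le> i" "x (i + 1) + (m + 1) \<le> x i" using a by (auto simp: cfg_allowed_def)
  have le: "i + m \<le> n" by (rule cfg_allowed_bound[OF x a])
  have "y 0 = 0" "\<forall>j>n. y j = 0"
    using x i le by (auto simp: y cfg_fire_def partitions_def)
  moreover have "y (k + 1) \<le> y k" if "k \<in> {1..<n}" for k
  proof -
    have "x (k + 1) \<le> x k" using x that by (auto simp: partitions_def)
    then show ?thesis using i by (auto simp: y cfg_fire_def)
  qed
  moreover have "(\<Sum>k=1..n. y k) = n"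
  proof -
    have "(\<Sum>k=1..n. y k + (if k = i then m else 0))
        = (\<Sum>k=1..n. x k + (if k \<in> {i+1..i+m} then 1 else 0))"
      by (rule sum.cong) (use i in \<open>auto simp: y cfg_fire_def\<close>)
    moreover have "(\<Sum>k=1..n. if k = i then m else 0) = m"
      using i le by simp
    moreover have "(\<Sum>k=1..n. if k \<in> {i+1..i+m} then 1 else 0::nat) = m"
      using le by (simp add: sum.If_cases min_absorb2 del: atLeastAtMost_iff)
    moreover have "(\<Sum>k=1..n. x k) = n" using x by (simp add: partitions_def)
    ultimately show ?thesis by (simp add: sum.distrib)
  qed
  ultimately show ?thesis by (auto simp: partitions_def)
qed

end

(*
  Firing position i changes, among the differences x k - x (k + 1), only the i-th one downwards, so
  it disables no other position, and two firings commute. Hence the game has the diamond property: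
  two different moves from the same position can be completed by one further move each to a common
  position. The diamond property alone yields strong convergence: if N moves lead from x to a
  terminal t, then N - 1 moves lead from any successor of x to t.
*)
theory Submission
  imports Defs
begin

section \<open>Games with the diamond property\<close>

definition closed_under :: "'a set \<Rightarrow> ('a \<Rightarrow> 'a \<Rightarrow> bool) \<Rightarrow> bool" where
  "closed_under P M \<longleftrightarrow> (\<forall>x\<in>P. \<forall>y. M x y \<longrightarrow> y \<in> P)"

text \<open>Exactly one move on each side, not at most one, is what makes play lengths agree. The
  case \<open>y = z\<close> is excluded because \<open>y\<close> may be terminal.\<close>

definition diamond_on :: "'a set \<Rightarrow> ('a \<Rightarrow> 'a \<Rightarrow> bool) \<Rightarrow> bool" where
  "diamond_on P M \<longleftrightarrow> (\<forall>x\<in>P. \<forall>y z. M x y \<and> M x z \<and> y \<noteq> z \<longrightarrow> (\<exists>w. M y w \<and> M z w))"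

lemma closed_underD: "closed_under P M \<Longrightarrow> x \<in> P \<Longrightarrow> M x y \<Longrightarrow> y \<in> P"
  by (auto simp: closed_under_def)

lemma closed_under_relpowp: "closed_under P M \<Longrightarrow> (M ^^ k) x y \<Longrightarrow> x \<in> P \<Longrightarrow> y \<in> P"
  by (induction k arbitrary: y) (auto dest: closed_underD)

lemma relpowp_if_successively:
  "successively M xs \<Longrightarrow> xs \<noteq> [] \<Longrightarrow> (M ^^ (length xs - 1)) (hd xs) (last xs)"
proof (induction xs rule: rev_induct)
  case (snoc y xs)
  then show ?case
    by (cases xs rule: rev_cases) (auto simp: successively_append_iff hd_append)
qed simp

lemma finite_play_relpowp: "finite_play M x xs \<Longrightarrow> (M ^^ (length xs - 1)) x (last xs)"
  using relpowp_if_successively[of M xs] by (auto simp: finite_play_def)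

lemma infinite_play_relpowp: "infinite_play M x f \<Longrightarrow> (M ^^ k) x (f k)"
  by (induction k) (auto simp: infinite_play_def)

text \<open>Induction on the given path, whose first move leads to some \<open>x'\<close>. If
  \<open>x'\<close> differs from \<open>y\<close>, the diamond yields a common successor
  \<open>w\<close>; the induction hypothesis at \<open>x'\<close> brings \<open>w\<close> to
  \<open>t\<close> with one move fewer, and the move from \<open>y\<close> to \<open>w\<close> makes
  up for it.\<close>

lemma diamond_step_towards_terminal:
  assumes "closed_under P M" "diamond_on P M" "terminal M t"
  shows "(M ^^ N) x t \<Longrightarrow> M x y \<Longrightarrow> x \<in> P \<Longrightarrow> \<exists>N'. N = Suc N' \<and> (M ^^ N') y t"
proof (induction N arbitrary: x y)
  case 0
  then show ?case using assms(3) by (auto simp: terminal_def)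
next
  case (Suc N)
  obtain x' where x': "M x x'" "(M ^^ N) x' t"
    using Suc.prems(1) by (blast elim: relpowp_Suc_E2)
  show ?case
  proof (cases "x' = y")
    case False
    then obtain w where w: "M x' w" "M y w"
      using assms(2) Suc.prems(2,3) x'(1) unfolding diamond_on_def by blast
    obtain N' where "N = Suc N'" "(M ^^ N') w t"
      using Suc.IH[OF x'(2) w(1)] closed_underD[OF assms(1) Suc.prems(3) x'(1)] by blast
    with w(2) show ?thesis by (blast intro: relpowp_Suc_I2)
  qed (use x'(2) in blast)
qed

text \<open>Used in two ways: \<open>N = k + N'\<close> bounds the length of every play by
  \<open>N\<close>, and \<open>N' = 0\<close> forces \<open>y = t\<close>.\<close>

lemma diamond_steps_towards_terminal:
  assumes "closed_under P M" "diamond_on P M" "terminal M t" "(M ^^ N) x t" "x \<in> P"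
  shows "(M ^^ k) x y \<Longrightarrow> \<exists>N'. N = k + N' \<and> (M ^^ N') y t"
proof (induction k arbitrary: y)
  case 0
  then show ?case using assms(4) by simp
next
  case (Suc k)
  then obtain z where z: "(M ^^ k) x z" "M z y" by auto
  obtain N' where N': "N = k + N'" "(M ^^ N') z t" using Suc.IH[OF z(1)] by blast
  have "z \<in> P" by (rule closed_under_relpowp[OF assms(1) z(1) assms(5)])
  with diamond_step_towards_terminal[OF assms(1-3) N'(2) z(2)] N'(1) show ?case by auto
qed

lemma all_plays_converge_if_diamond:
  assumes "closed_under P M" "diamond_on P M" "terminal M t" "(M ^^ N) x t" "x \<in> P"
  shows "all_plays_converge M x t N"
  unfolding all_plays_converge_def
proof (intro conjI allI impI notI)
  note steps = diamond_steps_towards_terminal[OF assms]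
  show False if "\<exists>f. infinite_play M x f"
    \<comment> \<open>An infinite play would contain \<open>Suc N\<close> moves, more than the bound
      \<open>N\<close>.\<close>
    using that steps[OF infinite_play_relpowp[of M x _ "Suc N"]] by auto
  fix xs assume xs: "finite_play M x xs \<and> terminal M (last xs)"
  obtain N' where N': "N = length xs - 1 + N'" "(M ^^ N') (last xs) t"
    using steps[OF finite_play_relpowp] xs by blast
  \<comment> \<open>Otherwise the path to \<open>t\<close> would begin with a move out of the
    terminal position \<open>last xs\<close>.\<close>
  have "N' = 0"
    using N'(2) xs by (cases N') (auto simp: terminal_def elim: relpowp_Suc_E2 simp del: relpowp.simps)
  with N' show "last xs = t" "length xs - 1 = N" by auto
qed

lemma infinite_play_if_no_terminal_reachable:
  assumes "\<And>k y. (M ^^ k) x y \<Longrightarrow> \<not> terminal M y"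
  shows "\<exists>f. infinite_play M x f"
proof -
  \<comment> \<open>Dependent choice with reachability from \<open>x\<close> as invariant; the
    clause for \<open>k = 0\<close> pins the start to \<open>x\<close>.\<close>
  have "\<exists>f. \<forall>k. (M\<^sup>*\<^sup>* x (f k) \<and> (k = 0 \<longrightarrow> f k = x)) \<and> M (f k) (f (Suc k))"
  proof (rule dependent_nat_choice)
    fix y and k :: nat
    assume y: "M\<^sup>*\<^sup>* x y \<and> (k = 0 \<longrightarrow> y = x)"
    then obtain z where "M y z"
      using assms by (auto simp: rtranclp_power terminal_def)
    with y show "\<exists>z. (M\<^sup>*\<^sup>* x z \<and> (Suc k = 0 \<longrightarrow> z = x)) \<and> M y z"
      by (auto intro: rtranclp.rtrancl_into_rtrancl)
  qed auto
  then show ?thesis by (auto simp: infinite_play_def)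
qed

lemma continuable_forever_if_infinite_play:
  assumes "successively M xs" "xs \<noteq> []" "infinite_play M (last xs) g"
  shows "continuable_forever M xs"
proof -
  \<comment> \<open>The shift makes index \<open>length xs\<close> continue with \<open>g 1\<close>,
    since \<open>g 0\<close> is \<open>last xs\<close> and already occurs as the final entry of
    \<open>xs\<close>.\<close>
  let ?f = "\<lambda>k. if k < length xs then xs ! k else g (Suc k - length xs)"
  have "M (?f k) (?f (Suc k))" for k
  proof -
    consider "Suc k < length xs" | "Suc k = length xs" | "length xs \<le> k" by linarith
    then show ?thesis
    proof cases
      case 1
      then show ?thesis using assms(1) by (simp add: successively_conv_nth)
    next
      case 2
      then have "?f k = g 0" using assms(2,3)
        by (simp add: infinite_play_def last_conv_nth flip: 2)
      moreover have "?f (Suc k) = g (Suc 0)" by (simp flip: 2)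
      moreover have "M (g 0) (g (Suc 0))" using assms(3) unfolding infinite_play_def by blast
      ultimately show ?thesis by (simp only:)
    next
      case 3
      then show ?thesis using assms(3) by (simp add: infinite_play_def Suc_diff_le)
    qed
  qed
  then have "infinite_play M (hd xs) ?f"
    using assms(2) by (simp add: infinite_play_def hd_conv_nth)
  then show ?thesis unfolding continuable_forever_def by (intro exI[of _ ?f]) simp
qed

theorem strongly_convergent_if_diamond:
  assumes "closed_under P M" "diamond_on P M"
  shows "strongly_convergent P M"
  unfolding strongly_convergent_def
proof
  fix x assume x: "x \<in> P"
  show "(\<forall>xs. finite_play M x xs \<longrightarrow> continuable_forever M xs) \<or>
        (\<exists>t\<in>P. terminal M t \<and> (\<exists>N. all_plays_converge M x t N))"
  \<comment> \<open>If no terminal position is reachable from \<open>x\<close>, none is reachable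
    from the end of a play from \<open>x\<close>, so that play extends forever.\<close>
  proof (cases "\<exists>N t. (M ^^ N) x t \<and> terminal M t")
    case True
    then show ?thesis
      using all_plays_converge_if_diamond[OF assms _ _ x] closed_under_relpowp[OF assms(1) _ x]
      by blast
  next
    case False
    have "continuable_forever M xs" if xs: "finite_play M x xs" for xs
    proof -
      have "\<not> terminal M y" if "(M ^^ k) (last xs) y" for k y
        using relpowp_trans[OF finite_play_relpowp[OF xs] that] False by blast
      then obtain g where "infinite_play M (last xs) g"
        using infinite_play_if_no_terminal_reachable by metis
      then show ?thesis
        using xs continuable_forever_if_infinite_play by (auto simp: finite_play_def)
    qed
    then show ?thesis by blast
  qed
qed

section \<open>The diamond property of CFG\<close>

text \<open>As \<open>j \<noteq> i\<close>, entry \<open>j + 1\<close> can gain 1 only if entry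
  \<open>j\<close> does too, so the difference at \<open>j\<close> does not shrink.\<close>

lemma cfg_allowed_cfg_fire:
  assumes "cfg_allowed n m x i" "cfg_allowed n m x j" "i \<noteq> j"
  shows "cfg_allowed n m (cfg_fire m x i) j"
  using assms by (auto simp: cfg_allowed_def cfg_fire_def)

text \<open>Both firings add constants to entries. Allowedness gives \<open>x i \<ge> m\<close> and
  \<open>x j \<ge> m\<close>, so the natural-number subtraction never truncates and commutes with
  the increments.\<close>

lemma cfg_fire_commute:
  assumes "cfg_allowed n m x i" "cfg_allowed n m x j" "i \<noteq> j"
  shows "cfg_fire m (cfg_fire m x i) j = cfg_fire m (cfg_fire m x j) i"
  using assms by (auto simp: cfg_allowed_def cfg_fire_def fun_eq_iff)

text \<open>Different successors come from different indices; the common position is reached by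
  firing both.\<close>

lemma diamond_on_cfg_move: "diamond_on P (cfg_move n m)"
  unfolding diamond_on_def cfg_move_def
  using cfg_allowed_cfg_fire cfg_fire_commute by metis

theorem corollary1:
  fixes n m :: nat
  assumes "n \<ge> 1" and "m \<ge> 1"
  shows "strongly_convergent (partitions n) (cfg_move n m)"
proof (rule strongly_convergent_if_diamond)
  show "closed_under (partitions n) (cfg_move n m)"
    using cfg_move_partitions by (auto simp: closed_under_def)
qed (rule diamond_on_cfg_move)

end
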